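(* Every graph that contains a spanning triangle-tree and has at most three vertices of degree $3$ admits a nowhere-zero $3$-flow.
   Context: Graphs are finite, may contain parallel edges, but have no loops. Nowhere-zero $3$-flow: a pair $(D,f)$ where $D$ is an orientation of $G$ and $f:E(G)\to\{\pm1,\pm2\}$ satisfies $\sum_{e\in E_D^+(v)}f(e)=\sum_{e\in E_D^-(v)}f(e)$ for every vertex $v$, where $E_D^+(v)$, $E_D^-(v)$ are the sets of arcs leaving and entering $v$. Triangle-tree: a graph formed by starting with a triangle $x_1x_2x_3$ and then repeatedly (zero or more times) adding a new vertex $x_{j+1}$ joined to exactly two vertices $y,z$ that are adjacent in the graph already constructed (so $x_{j+1},y,z$ form a triangle). A spanning triangle-tree of $G$ is a subgraph of $G$ that is a triangle-tree and contains all vertices of $G$. *)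

theory Defs
  imports Main "Graph_Theory.Digraph"
begin

record ('v, 'e) mgraph =
  vertices :: "'v set"
  edges :: "'e set"
  ends :: "'e \<Rightarrow> 'v set"

text \<open>Finite undirected graphs: edges have an identity of their own, so parallel edges are
  possible; having exactly two distinct ends excludes loops.\<close>

locale multigraph =
  fixes G :: "('v, 'e) mgraph"
  assumes finite_vertices: "finite (vertices G)"
    and finite_edges: "finite (edges G)"
    and ends_subset: "e \<in> edges G \<Longrightarrow> ends G e \<subseteq> vertices G"
    and card_ends: "e \<in> edges G \<Longrightarrow> card (ends G e) = 2"

definition degree :: "('v, 'e) mgraph \<Rightarrow> 'v \<Rightarrow> nat" where
  "degree G v = card {e \<in> edges G. v \<in> ends G e}"

definition subgraph_of :: "('v, 'e) mgraph \<Rightarrow> ('v, 'e) mgraph \<Rightarrow> bool" where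
  "subgraph_of H G \<longleftrightarrow>
     multigraph H \<and> vertices H \<subseteq> vertices G \<and> edges H \<subseteq> edges G \<and>
     (\<forall>e\<in>edges H. ends H e = ends G e)"

definition orientation_of :: "('v, 'e) pre_digraph \<Rightarrow> ('v, 'e) mgraph \<Rightarrow> bool" where
  "orientation_of D G \<longleftrightarrow>
     verts D = vertices G \<and> arcs D = edges G \<and>
     (\<forall>e\<in>edges G. {tail D e, head D e} = ends G e)"

definition nowhere_zero_3_flow ::
    "('v, 'e) mgraph \<Rightarrow> ('v, 'e) pre_digraph \<Rightarrow> ('e \<Rightarrow> int) \<Rightarrow> bool" where
  "nowhere_zero_3_flow G D f \<longleftrightarrow>
     orientation_of D G \<and>
     (\<forall>e\<in>edges G. f e \<in> {1, -1, 2, -2}) \<and>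
     (\<forall>v\<in>vertices G. (\<Sum>e\<in>out_arcs D v. f e) = (\<Sum>e\<in>in_arcs D v. f e))"

text \<open>\<open>triangle_tree_on \<eta> V E\<close>: the graph with vertex set \<open>V\<close>, edge set \<open>E\<close> and end map \<open>\<eta>\<close>
  is a triangle-tree. In the second rule the new edges \<open>a\<close> and \<open>b\<close> are automatically not in \<open>E\<close>,
  since \<open>x\<close> is not in \<open>V\<close>, which contains all ends of the edges in \<open>E\<close>.\<close>

inductive triangle_tree_on :: "('e \<Rightarrow> 'v set) \<Rightarrow> 'v set \<Rightarrow> 'e set \<Rightarrow> bool"
  for \<eta> :: "'e \<Rightarrow> 'v set" where
  triangle:
    "\<lbrakk>distinct [x1, x2, x3]; \<eta> a = {x1, x2}; \<eta> b = {x1, x3}; \<eta> c = {x2, x3}\<rbrakk>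
     \<Longrightarrow> triangle_tree_on \<eta> {x1, x2, x3} {a, b, c}"
| add_vertex:
    "\<lbrakk>triangle_tree_on \<eta> V E; e \<in> E; \<eta> e = {y, z}; y \<noteq> z; x \<notin> V;
      \<eta> a = {x, y}; \<eta> b = {x, z}\<rbrakk>
     \<Longrightarrow> triangle_tree_on \<eta> (insert x V) (insert a (insert b E))"

definition triangle_tree :: "('v, 'e) mgraph \<Rightarrow> bool" where
  "triangle_tree H \<longleftrightarrow> triangle_tree_on (ends H) (vertices H) (edges H)"

definition spanning_triangle_tree :: "('v, 'e) mgraph \<Rightarrow> ('v, 'e) mgraph \<Rightarrow> bool" where
  "spanning_triangle_tree H G \<longleftrightarrow>
     subgraph_of H G \<and> vertices H = vertices G \<and> triangle_tree H"

end

(* Let T be the spanning triangle-tree, R its set of triangles, c its proper 3-colouring, and M the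
   set of edges of G outside T. By Tutte it suffices to find signs on the edges whose net outflow
   vanishes modulo 3. By induction along T, every beta with sum 0 modulo 3 is either the net outflow
   of signs on T, or of the form v |-> (sum of s D over the triangles D containing v) for signs s on
   R: if x is the last vertex, on the edge yz, then two different representations after removing x
   would represent 2 (d_y - d_z), where d_v is the indicator of v; but a triangle meets every colour
   class exactly once, so y and z would have the same colour.

   Suppose that no flow exists. Then every choice of signs on M produces a representable beta. Hence
   the ends u, w of each m in M have the same colour, and d_u - d_w is a combination of triangles
   with coefficients L m D in {-1, 0, 1}. As the triangles are independent modulo 3, no signed sum of
   the L m D over m vanishes modulo 3, so exactly one of them is nonzero: the supports of the L m
   partition R. Therefore 2 |M| <= |R| = n - 2 and every degree is odd and at least 3. As
   |E(T)| = 2 n - 3, the degrees sum to at most 5 n - 8, so at least four of them are 3. *)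

theory Submission
  imports Defs "HOL-Number_Theory.Cong"
begin

section \<open>Preliminaries: paths that never return to their start, and sums of signs modulo
  3\<close>

text \<open>Cutting a path at its last visit to \<open>u\<close> leaves one step out of
  \<open>u\<close> and a rest that avoids \<open>u\<close>. This permits induction on the edges away
  from \<open>u\<close>.\<close>

lemma rtrancl_avoid_start:
  assumes "(u, w) \<in> r\<^sup>*" "u \<noteq> w"
  shows "\<exists>v. (u, v) \<in> r \<and> (v, w) \<in> {(p, q) \<in> r. p \<noteq> u \<and> q \<noteq> u}\<^sup>*"
  using assms
proof (induction rule: rtrancl_induct)
  case base
  then show ?case by simp
next
  case (step y z)
  show ?case
  proof (cases "y = u")
    case True
    then show ?thesis using step.hyps by blast
  next
    case False
    then obtain v where "(u, v) \<in> r" "(v, y) \<in> {(p, q) \<in> r. p \<noteq> u \<and> q \<noteq> u}\<^sup>*"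
      using step.IH by auto
    moreover have "(y, z) \<in> {(p, q) \<in> r. p \<noteq> u \<and> q \<noteq> u}"
      using False step.hyps step.prems by auto
    ultimately show ?thesis by (meson rtrancl.rtrancl_into_rtrancl)
  qed
qed

lemma cong_3_cases: "[k = 0] (mod 3) \<or> [k = 1] (mod 3) \<or> [k = -1] (mod 3)" for k :: int
  by (simp add: cong_iff_dvd_diff) presburger

text \<open>A single sign already reaches both nonzero residues, and one further sign can always be
  chosen so that a nonzero residue remains for the others. Zero has to be excluded because one sign
  alone cannot reach it.\<close>

lemma signs_sum_cong:
  assumes "finite N" "N \<noteq> {}" "\<not> [r = 0] (mod 3)"
  shows "\<exists>\<sigma>::'a \<Rightarrow> int. (\<forall>m. \<sigma> m \<in> {1, -1}) \<and> [(\<Sum>m\<in>N. \<sigma> m) = r] (mod 3)"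
  using assms
proof (induction arbitrary: r rule: finite_ne_induct)
  case (singleton p)
  then have "[1 = r] (mod 3) \<or> [-1 = r] (mod 3)"
    by (simp add: cong_iff_dvd_diff) presburger
  then show ?case
  proof
    assume "[1 = r] (mod 3)"
    then show ?thesis by (intro exI[of _ "\<lambda>_. 1"]) simp
  next
    assume "[-1 = r] (mod 3)"
    then show ?thesis by (intro exI[of _ "\<lambda>_. -1"]) simp
  qed
next
  case (insert p N)
  \<comment> \<open>With \<open>q\<close> congruent to \<open>- r\<close> the remaining target
    \<open>r - q\<close> is congruent to \<open>- r\<close>, hence again nonzero.\<close>
  obtain q :: int where q: "q \<in> {1, -1}" "[q = - r] (mod 3)"
  proof -
    have "[1 = - r] (mod 3) \<or> [-1 = - r] (mod 3)"
      using insert.prems by (simp add: cong_iff_dvd_diff) presburger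
    then show ?thesis using that by blast
  qed
  have "\<not> [r - q = 0] (mod 3)"
    using q insert.prems by (auto simp: cong_iff_dvd_diff) presburger+
  then obtain \<sigma> :: "'a \<Rightarrow> int" where s: "\<forall>m. \<sigma> m \<in> {1, -1}" "[(\<Sum>m\<in>N. \<sigma> m) = r - q] (mod 3)"
    using insert.IH by blast
  have "(\<Sum>m\<in>insert p N. (\<sigma>(p := q)) m) = q + (\<Sum>m\<in>N. \<sigma> m)"
    using insert.hyps by (auto intro: sum.cong)
  moreover have "[q + (\<Sum>m\<in>N. \<sigma> m) = r] (mod 3)"
    using cong_add[OF cong_refl s(2), of q] by simp
  ultimately show ?case using s(1) q(1)
    by (intro exI[of _ "\<sigma>(p := q)"]) auto
qed

text \<open>On the support \<open>N\<close> of \<open>a\<close> the products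
  \<open>b m * a m\<close> run through all sign patterns. An empty \<open>N\<close> gives the sum 0,
  and with at least two elements some pattern sums to 0 modulo 3; so \<open>N\<close> is a
  singleton.\<close>

lemma unique_nonzero_coefficient:
  fixes a :: "'a \<Rightarrow> int"
  assumes fin: "finite M" and a: "\<And>m. m \<in> M \<Longrightarrow> a m \<in> {-1, 0, 1}"
    and nz: "\<And>b. (\<And>m. b m \<in> {1, -1}) \<Longrightarrow> \<not> [(\<Sum>m\<in>M. b m * a m) = 0] (mod 3)"
  shows "(\<Sum>m\<in>M. \<bar>a m\<bar>) = 1"
proof -
  define N where "N = {m \<in> M. a m \<noteq> 0}"
  have finN: "finite N" using fin by (simp add: N_def)
  have red: "\<not> [(\<Sum>m\<in>N. \<sigma> m) = 0] (mod 3)" if s: "\<And>m. \<sigma> m \<in> {1, -1}" for \<sigma> :: "'a \<Rightarrow> int"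
  proof -
    \<comment> \<open>On \<open>N\<close> the square of \<open>a m\<close> is 1, so multiplying by
      \<open>a m\<close> once more restores \<open>\<sigma> m\<close>.\<close>
    define b where "b = (\<lambda>m. if m \<in> N then \<sigma> m * a m else 1)"
    have "b m \<in> {1, -1}" for m
      using s[of m] a[of m] by (auto simp: b_def N_def)
    moreover have "(\<Sum>m\<in>M. b m * a m) = (\<Sum>m\<in>N. \<sigma> m)"
    proof (rule sum.mono_neutral_cong_right)
      show "\<forall>i\<in>M - N. b i * a i = 0" by (auto simp: N_def)
      show "b m * a m = \<sigma> m" if "m \<in> N" for m
        using that a[of m] by (auto simp: b_def N_def)
    qed (auto simp: N_def fin)
    ultimately show ?thesis using nz[of b] by simp
  qed
  have "N \<noteq> {}" using red[of "\<lambda>_. 1"] by auto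
  then obtain p where p: "p \<in> N" by blast
  have "N - {p} = {}"
  proof (rule ccontr)
    assume "N - {p} \<noteq> {}"
    then obtain \<sigma> :: "'a \<Rightarrow> int" where s: "\<forall>m. \<sigma> m \<in> {1, -1}"
      "[(\<Sum>m\<in>N - {p}. \<sigma> m) = -1] (mod 3)"
      using signs_sum_cong[of "N - {p}" "-1"] finN by (auto simp: cong_def)
    have "(\<Sum>m\<in>N. (\<sigma>(p := 1)) m) = 1 + (\<Sum>m\<in>N - {p}. \<sigma> m)"
      using p finN by (subst sum.remove[of _ p]) (auto intro: sum.cong)
    moreover have "[1 + (\<Sum>m\<in>N - {p}. \<sigma> m) = 0] (mod 3)"
      using cong_add[OF cong_refl s(2), of 1] by simp
    moreover have "(\<sigma>(p := 1)) m \<in> {1, -1}" for m using s(1) by simp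
    ultimately show False using red[of "\<sigma>(p := 1)"] by metis
  qed
  then have N: "N = {p}" using p by blast
  have "p \<in> M" "a p \<noteq> 0" using p by (auto simp: N_def)
  have "(\<Sum>m\<in>M. \<bar>a m\<bar>) = (\<Sum>m\<in>N. \<bar>a m\<bar>)"
    by (rule sum.mono_neutral_right) (auto simp: N_def fin)
  also have "\<dots> = 1" using a[of p] \<open>p \<in> M\<close> \<open>a p \<noteq> 0\<close> unfolding N by auto
  finally show ?thesis .
qed

section \<open>Net outflow, and Tutte's passage from flows modulo 3 to integer flows\<close>

context
  fixes t h :: "'e \<Rightarrow> 'v"
begin

text \<open>This is the signed incidence matrix of an orientation fixed once and for all. Edges are
  never reversed; their values change sign instead.\<close>

definition inc :: "'e \<Rightarrow> 'v \<Rightarrow> int" where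
  "inc e v = of_bool (v = t e) - of_bool (v = h e)"

definition net :: "('e \<Rightarrow> int) \<Rightarrow> 'e set \<Rightarrow> 'v \<Rightarrow> int" where
  "net f E v = (\<Sum>e\<in>E. f e * inc e v)"

lemma net_eq_0:
  assumes "\<And>e. e \<in> E \<Longrightarrow> t e \<noteq> v \<and> h e \<noteq> v"
  shows "net f E v = 0"
  unfolding net_def using assms by (intro sum.neutral) (auto simp: inc_def)

lemma sum_net:
  assumes "finite V" and "\<And>e. e \<in> E \<Longrightarrow> t e \<in> V \<and> h e \<in> V"
  shows "(\<Sum>v\<in>V. net f E v) = 0"
proof -
  have "(\<Sum>v\<in>V. net f E v) = (\<Sum>e\<in>E. f e * (\<Sum>v\<in>V. inc e v))"
    unfolding net_def by (subst sum.swap) (simp add: sum_distrib_left)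
  also have "\<dots> = 0"
  proof (rule sum.neutral, rule ballI)
    fix e assume "e \<in> E"
    then have "(\<Sum>v\<in>V. inc e v) = 0"
      using assms by (simp add: inc_def sum_subtractf of_bool_def sum.delta)
    then show "f e * (\<Sum>v\<in>V. inc e v) = 0" by simp
  qed
  finally show ?thesis .
qed

text \<open>Each edge points the way its flow actually runs. Along such a path from \<open>u\<close>
  to \<open>w\<close> the flow can be lowered by 3, which moves 3 units of excess from
  \<open>u\<close> to \<open>w\<close>.\<close>

definition residual :: "('e \<Rightarrow> int) \<Rightarrow> 'e set \<Rightarrow> ('v \<times> 'v) set" where
  "residual f E = {(p, q). \<exists>e\<in>E. p = t e \<and> q = h e \<and> f e > 0 \<or> p = h e \<and> q = t e \<and> f e < 0}"

text \<open>Pushing 3 units along an edge of value 1 or 2 turns the value into -2 or -1. Hence values stay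
  nonzero as long as the path uses no edge twice, which induction on the edges away from \<open>u\<close> ensures.\<close>

lemma push_along_residual_path:
  assumes "finite E" "\<And>e. e \<in> E \<Longrightarrow> f e \<in> {1, -1, 2, -2}" "(u, w) \<in> (residual f E)\<^sup>*"
  shows "\<exists>g. (\<forall>e\<in>E. g e \<in> {1, -1, 2, -2}) \<and>
    (\<forall>v. net g E v = net f E v - 3 * of_bool (v = u) + 3 * of_bool (v = w))"
  using assms
proof (induction "card E" arbitrary: E u rule: less_induct)
  case less
  show ?case
  proof (cases "u = w")
    case True
    then show ?thesis using less.prems by (intro exI[of _ f]) auto
  next
    case False
    define E' where "E' = {e \<in> E. t e \<noteq> u \<and> h e \<noteq> u}"
    obtain v1 where v1: "(u, v1) \<in> residual f E"
      "(v1, w) \<in> {(p, q) \<in> residual f E. p \<noteq> u \<and> q \<noteq> u}\<^sup>*"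
      using rtrancl_avoid_start[OF less.prems(3) False] by blast
    have "{(p, q) \<in> residual f E. p \<noteq> u \<and> q \<noteq> u} \<subseteq> residual f E'"
      by (auto simp: residual_def E'_def)
    then have path: "(v1, w) \<in> (residual f E')\<^sup>*"
      using v1(2) rtrancl_mono by blast
    obtain e0 where e0: "e0 \<in> E"
      "u = t e0 \<and> v1 = h e0 \<and> f e0 > 0 \<or> u = h e0 \<and> v1 = t e0 \<and> f e0 < 0"
      using v1(1) by (auto simp: residual_def)
    have e0': "e0 \<notin> E'" using e0 by (auto simp: E'_def)
    have sub: "E' \<subseteq> E" by (auto simp: E'_def)
    have "card E' < card E"
      using less.prems(1) e0(1) e0' sub by (metis psubset_card_mono psubsetI)
    then have "\<exists>g. (\<forall>e\<in>E'. g e \<in> {1, -1, 2, -2}) \<and>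
      (\<forall>v. net g E' v = net f E' v - 3 * of_bool (v = v1) + 3 * of_bool (v = w))"
    proof (rule less.hyps)
      show "finite E'" using sub less.prems(1) by (rule finite_subset)
      show "f e \<in> {1, -1, 2, -2}" if "e \<in> E'" for e
        using that sub less.prems(2) by blast
    qed (rule path)
    then obtain g' where g': "\<forall>e\<in>E'. g' e \<in> {1, -1, 2, -2}"
      "\<And>v. net g' E' v = net f E' v - 3 * of_bool (v = v1) + 3 * of_bool (v = w)"
      by blast
    define g where "g = (\<lambda>e. if e \<in> E' then g' e else if e = e0 then f e - 3 * sgn (f e) else f e)"
    have split: "net k E v = net k E' v + k e0 * inc e0 v + net k (E - E' - {e0}) v" for k v
    proof -
      have "net k E v = net k E' v + net k (E - E') v"
        unfolding net_def using sum.subset_diff[OF sub less.prems(1)] by (simp add: add.commute)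
      also have "net k (E - E') v = k e0 * inc e0 v + net k (E - E' - {e0}) v"
        unfolding net_def using e0 e0' less.prems(1) by (subst sum.remove[of _ e0]) auto
      finally show ?thesis by simp
    qed
    have "net g E v = net f E v - 3 * of_bool (v = u) + 3 * of_bool (v = w)" for v
    proof -
      have 1: "net g E' v = net g' E' v"
        unfolding net_def by (rule sum.cong) (auto simp: g_def)
      have 2: "net g (E - E' - {e0}) v = net f (E - E' - {e0}) v"
        unfolding net_def by (rule sum.cong) (auto simp: g_def)
      have 3: "g e0 * inc e0 v = f e0 * inc e0 v - 3 * of_bool (v = u) + 3 * of_bool (v = v1)"
        using e0(2) e0' by (auto simp: g_def inc_def)
      show ?thesis
        using split[of g v] split[of f v] 1 2 3 g'(2)[of v] by linarith
    qed
    moreover have "\<forall>e\<in>E. g e \<in> {1, -1, 2, -2}"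
    proof
      fix e assume "e \<in> E"
      then have "f e \<in> {1, -1, 2, -2}" by (rule less.prems(2))
      then show "g e \<in> {1, -1, 2, -2}" using g'(1) by (auto simp: g_def)
    qed
    ultimately show ?thesis by blast
  qed
qed

text \<open>Tutte's theorem for modulus 3, by descent on the total absolute excess: from a vertex of
  positive excess some vertex of negative excess is reachable along the flow, and moving 3 units
  between them lowers the total.\<close>

lemma integer_flow_of_mod_3_flow:
  assumes fin: "finite V" "finite E" and ends: "\<And>e. e \<in> E \<Longrightarrow> t e \<in> V \<and> h e \<in> V"
    and "\<And>e. e \<in> E \<Longrightarrow> f e \<in> {1, -1, 2, -2}" and "\<And>v. v \<in> V \<Longrightarrow> 3 dvd net f E v"
  shows "\<exists>g. (\<forall>e\<in>E. g e \<in> {1, -1, 2, -2}) \<and> (\<forall>v\<in>V. net g E v = 0)"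
  using assms(4,5)
proof (induction "nat (\<Sum>v\<in>V. \<bar>net f E v\<bar>)" arbitrary: f rule: less_induct)
  case less
  show ?case
  proof (cases "\<forall>v\<in>V. net f E v = 0")
    case True
    then show ?thesis using less.prems by blast
  next
    case False
    have "\<exists>v\<in>V. net f E v > 0"
    proof (rule ccontr)
      assume "\<not> ?thesis"
      then have "\<forall>v\<in>V. 0 \<le> - net f E v" by auto
      moreover have "(\<Sum>v\<in>V. - net f E v) = 0"
        using sum_net[OF fin(1) ends] by (simp add: sum_negf)
      ultimately have "\<forall>v\<in>V. - net f E v = 0"
        using sum_nonneg_eq_0_iff[OF fin(1), of "\<lambda>v. - net f E v"] by simp
      then show False using False by auto
    qed
    then obtain u where u: "u \<in> V" "net f E u > 0" by blast
    \<comment> \<open>No flow leaves the reachable set \<open>X\<close>, so its total excess is at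
      most 0. As \<open>u\<close> contributes a positive amount, \<open>X\<close> contains a vertex
      of negative excess.\<close>
    define X where "X = (residual f E)\<^sup>* `` {u}"
    have XV: "X \<subseteq> V"
    proof
      fix x assume "x \<in> X"
      then have "(u, x) \<in> (residual f E)\<^sup>*" by (simp add: X_def)
      then show "x \<in> V"
        by (induction rule: rtrancl_induct) (use u ends in \<open>auto simp: residual_def\<close>)
    qed
    have finX: "finite X" using XV fin(1) finite_subset by blast
    have closed: "q \<in> X" if "p \<in> X" "(p, q) \<in> residual f E" for p q
      using that unfolding X_def by (auto intro: rtrancl_into_rtrancl)
    have "(\<Sum>v\<in>X. net f E v) = (\<Sum>e\<in>E. f e * (\<Sum>v\<in>X. inc e v))"
      unfolding net_def by (subst sum.swap) (simp add: sum_distrib_left)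
    also have "\<dots> \<le> 0"
    proof (rule sum_nonpos)
      fix e assume e: "e \<in> E"
      have "(\<Sum>v\<in>X. inc e v) = of_bool (t e \<in> X) - of_bool (h e \<in> X)"
        using finX by (simp add: inc_def sum_subtractf of_bool_def sum.delta)
      moreover have "f e \<le> 0" if "t e \<in> X" "h e \<notin> X"
        using closed[OF that(1), of "h e"] that e by (force simp: residual_def)
      moreover have "f e \<ge> 0" if "h e \<in> X" "t e \<notin> X"
        using closed[OF that(1), of "t e"] that e by (force simp: residual_def)
      ultimately show "f e * (\<Sum>v\<in>X. inc e v) \<le> 0" by (auto simp: of_bool_def)
    qed
    finally have le: "(\<Sum>v\<in>X. net f E v) \<le> 0" .
    have uX: "u \<in> X" by (simp add: X_def)
    have "\<exists>w\<in>X. net f E w < 0"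
    proof (rule ccontr)
      assume "\<not> ?thesis"
      then have "(\<Sum>v\<in>X. net f E v) > 0"
        using uX u(2) finX by (intro sum_pos2[where i = u]) auto
      then show False using le by simp
    qed
    then obtain w where w: "w \<in> X" "net f E w < 0" by blast
    have "\<exists>g. (\<forall>e\<in>E. g e \<in> {1, -1, 2, -2}) \<and>
      (\<forall>v. net g E v = net f E v - 3 * of_bool (v = u) + 3 * of_bool (v = w))"
    proof (rule push_along_residual_path[OF fin(2) less.prems(1)])
      show "(u, w) \<in> (residual f E)\<^sup>*" using w(1) by (simp add: X_def)
    qed
    then obtain g where g: "\<forall>e\<in>E. g e \<in> {1, -1, 2, -2}"
      "\<And>v. net g E v = net f E v - 3 * of_bool (v = u) + 3 * of_bool (v = w)"
      by blast
    have uw: "u \<noteq> w" using u w by auto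
    \<comment> \<open>Divisibility by 3 makes both excesses at least 3 in absolute value, so the
      push overshoots at neither end.\<close>
    have u3: "net f E u \<ge> 3" using u less.prems(2)[of u] by (simp add: zdvd_imp_le)
    have "3 dvd - net f E w" using w XV less.prems(2)[of w] by auto
    then have w3: "net f E w \<le> -3" using w zdvd_imp_le[of 3 "- net f E w"] by linarith
    have "(\<Sum>v\<in>V. \<bar>net g E v\<bar>) < (\<Sum>v\<in>V. \<bar>net f E v\<bar>)"
    proof (rule sum_strict_mono_ex1)
      show "\<forall>v\<in>V. \<bar>net g E v\<bar> \<le> \<bar>net f E v\<bar>"
        using g(2) u3 w3 uw by (auto simp: of_bool_def)
      show "\<exists>v\<in>V. \<bar>net g E v\<bar> < \<bar>net f E v\<bar>"
        using g(2) u3 uw u(1) by (intro bexI[of _ u]) auto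
    qed (rule fin(1))
    moreover have "(\<Sum>v\<in>V. \<bar>net g E v\<bar>) \<ge> 0" by (rule sum_nonneg) simp
    ultimately have "nat (\<Sum>v\<in>V. \<bar>net g E v\<bar>) < nat (\<Sum>v\<in>V. \<bar>net f E v\<bar>)"
      by linarith
    moreover have "3 dvd net g E v" if "v \<in> V" for v
      using g(2)[of v] less.prems(2)[OF that] by (simp add: dvd_diff)
    ultimately show ?thesis using less.hyps[of g] g(1) by blast
  qed
qed

section \<open>Triangle-trees built by stacking, with their colouring and their triangles\<close>

text \<open>Triangle-trees together with a proper 3-colouring \<open>c\<close> and the set \<open>R\<close> of the triangles that
  were stacked. Starting from an edge rather than from a triangle shortens the inductions.\<close>

inductive stacked :: "('v \<Rightarrow> nat) \<Rightarrow> 'v set \<Rightarrow> 'e set \<Rightarrow> 'v set set \<Rightarrow> bool" for c where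
  edge: "\<lbrakk>c (t a) < 3; c (h a) < 3; c (t a) \<noteq> c (h a)\<rbrakk> \<Longrightarrow> stacked c {t a, h a} {a} {}"
| triangle: "\<lbrakk>stacked c V E R; e \<in> E; x \<notin> V; {t a, h a} = {x, t e}; {t b, h b} = {x, h e};
    c x < 3; c x \<noteq> c (t e); c x \<noteq> c (h e)\<rbrakk>
    \<Longrightarrow> stacked c (insert x V) (insert a (insert b E)) (insert {x, t e, h e} R)"

lemma stacked_finite: "stacked c V E R \<Longrightarrow> finite V \<and> finite E \<and> finite R"
  by (induction rule: stacked.induct) auto

lemma stacked_ends:
  "stacked c V E R \<Longrightarrow> e \<in> E \<Longrightarrow> t e \<in> V \<and> h e \<in> V \<and> c (t e) \<noteq> c (h e)"
proof (induction arbitrary: e rule: stacked.induct)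
  case (triangle V E R e x a b e')
  have e: "t e \<in> V" "h e \<in> V" using triangle.IH triangle.hyps(2) by auto
  consider "e' = a" | "e' = b" | "e' \<in> E" using triangle.prems by blast
  then show ?case
  proof cases
    case 1
    then show ?thesis using triangle.hyps e by (auto simp: doubleton_eq_iff)
  next
    case 2
    then show ?thesis using triangle.hyps e by (auto simp: doubleton_eq_iff)
  next
    case 3
    then show ?thesis using triangle.IH by blast
  qed
qed simp

lemma stacked_colour: "stacked c V E R \<Longrightarrow> v \<in> V \<Longrightarrow> c v < 3"
  by (induction rule: stacked.induct) auto

lemma stacked_triangle_subset: "stacked c V E R \<Longrightarrow> D \<in> R \<Longrightarrow> D \<subseteq> V"
proof (induction rule: stacked.induct)
  case (triangle V E R e x a b)
  then show ?case using stacked_ends[OF triangle.hyps(1,2)] by blast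
qed simp

lemma stacked_cong:
  "stacked c V E R \<Longrightarrow> (\<And>v. v \<in> V \<Longrightarrow> c' v = c v) \<Longrightarrow> stacked c' V E R"
proof (induction rule: stacked.induct)
  case (edge a)
  then have "c' (t a) = c (t a)" "c' (h a) = c (h a)" by blast+
  then show ?case using edge.hyps stacked.edge[of c' a] by metis
next
  case (triangle V E R e x a b)
  have "stacked c' V E R" using triangle.IH triangle.prems by simp
  moreover have "c' x = c x" "c' (t e) = c (t e)" "c' (h e) = c (h e)"
    using stacked_ends[OF triangle.hyps(1,2)] triangle.prems by blast+
  ultimately show ?case
    using stacked.triangle[of c' V E R, OF _ triangle.hyps(2-5)] triangle.hyps(6-8) by metis
qed

lemma stacked_new:
  assumes "stacked c V E R" "x \<notin> V" "{t a, h a} = {x, y}" "{t b, h b} = {x, z}" "y \<noteq> z"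
  shows "a \<notin> E" "b \<notin> E" "a \<noteq> b" "{x, p, q} \<notin> R"
proof -
  have x: "g \<notin> E" if "{t g, h g} = {x, u}" for g u
  proof
    assume "g \<in> E"
    then have "{t g, h g} \<subseteq> V" using stacked_ends[OF assms(1)] by simp
    then show False using assms(2) that by simp
  qed
  show "a \<notin> E" "b \<notin> E" using x[OF assms(3)] x[OF assms(4)] .
  show "a \<noteq> b"
  proof
    assume "a = b"
    then have "{x, y} = {x, z}" using assms(3,4) by simp
    then show False using assms(5) by (simp add: doubleton_eq_iff)
  qed
  show "{x, p, q} \<notin> R"
  proof
    assume "{x, p, q} \<in> R"
    from stacked_triangle_subset[OF assms(1) this] show False using assms(2) by simp
  qed
qed

lemma stacked_card: "stacked c V E R \<Longrightarrow> card V = card R + 2 \<and> card E = 2 * card R + 1"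
proof (induction rule: stacked.induct)
  case (edge a)
  then have "t a \<noteq> h a" by auto
  then show ?case by simp
next
  case (triangle V E R e x a b)
  have "t e \<noteq> h e" using stacked_ends[OF triangle.hyps(1,2)] by auto
  note stacked_new[OF triangle.hyps(1,3,4,5) this]
  then show ?case using triangle.IH triangle.hyps(3) stacked_finite[OF triangle.hyps(1)] by simp
qed

text \<open>This supplies the triangle on the far side of an edge on which a new vertex is stacked.
  New edges lie in the new triangle; an old edge lacks an old triangle only while the graph is a
  single edge, and then the new triangle contains it.\<close>

lemma stacked_edge_apex:
  "stacked c V E R \<Longrightarrow> e \<in> E \<Longrightarrow>
    V = {t e, h e} \<or> (\<exists>w. w \<notin> {t e, h e} \<and> {w, t e, h e} \<in> R)"
proof (induction arbitrary: e rule: stacked.induct)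
  case (edge a)
  then show ?case by simp
next
  case (triangle V E R e x a b e')
  note ends = stacked_ends[OF triangle.hyps(1,2)]
  consider "e' = a" | "e' = b" | "e' \<in> E" using triangle.prems by blast
  then show ?case
  proof cases
    case 1
    then have "{h e, t e', h e'} = {x, t e, h e}" "h e \<notin> {t e', h e'}"
      using triangle.hyps(3,4) ends by auto
    then show ?thesis by auto
  next
    case 2
    then have "{t e, t e', h e'} = {x, t e, h e}" "t e \<notin> {t e', h e'}"
      using triangle.hyps(3,5) ends by auto
    then show ?thesis by auto
  next
    case 3
    show ?thesis
    proof (cases "V = {t e', h e'}")
      case True
      then have "{t e, h e} = {t e', h e'}" using ends by auto
      then show ?thesis using True triangle.hyps(3) by (intro disjI2 exI[of _ x]) auto
    next
      case False
      then show ?thesis using triangle.IH[OF 3] by auto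
    qed
  qed
qed

lemma stacked_covered: "stacked c V E R \<Longrightarrow> R \<noteq> {} \<Longrightarrow> v \<in> V \<Longrightarrow> \<exists>D\<in>R. v \<in> D"
proof (induction rule: stacked.induct)
  case (triangle V E R e x a b)
  have "R = {} \<Longrightarrow> V = {t e, h e}"
    using stacked_edge_apex[OF triangle.hyps(1,2)] by auto
  then show ?case using triangle by (cases "R = {}") auto
qed simp

text \<open>The three corners carry three different colours out of three. The equivalence with
  \<open>v = w\<close> lets a sum over a colour class collapse to a single term.\<close>

lemma stacked_rainbow:
  "stacked c V E R \<Longrightarrow> D \<in> R \<Longrightarrow> k < 3 \<Longrightarrow> \<exists>w. \<forall>v. v \<in> D \<and> c v = k \<longleftrightarrow> v = w"
proof (induction rule: stacked.induct)
  case (triangle V E R e x a b)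
  note ends = stacked_ends[OF triangle.hyps(1,2)]
  have col: "c (t e) < 3" "c (h e) < 3"
    using ends stacked_colour[OF triangle.hyps(1)] by auto
  show ?case
  proof (cases "D \<in> R")
    case False
    then have D: "D = {x, t e, h e}" using triangle.prems by simp
    consider "c x = k" | "c (t e) = k" | "c (h e) = k"
      using col ends triangle.hyps triangle.prems(2) by linarith
    then show ?thesis
    proof cases
      case 1
      then show ?thesis using D ends triangle.hyps by (intro exI[of _ x]) auto
    next
      case 2
      then show ?thesis using D ends triangle.hyps by (intro exI[of _ "t e"]) auto
    next
      case 3
      then show ?thesis using D ends triangle.hyps by (intro exI[of _ "h e"]) auto
    qed
  qed (use triangle in auto)
qed simp

section \<open>Integer combinations of triangles modulo 3\<close>

text \<open>Arbitrary integer coefficients are allowed, since besides signs the differences of two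
  sign patterns, the coefficients of links and the constant 1, which counts the triangles at a
  vertex, all occur.\<close>

definition tri_sum :: "('v set \<Rightarrow> int) \<Rightarrow> 'v set set \<Rightarrow> 'v \<Rightarrow> int" where
  "tri_sum s R v = (\<Sum>D\<in>R. s D * of_bool (v \<in> D))"

lemma tri_sum_insert:
  "finite R \<Longrightarrow> D \<notin> R \<Longrightarrow> tri_sum s (insert D R) v = s D * of_bool (v \<in> D) + tri_sum s R v"
  by (simp add: tri_sum_def)

lemma tri_sum_outside: "stacked c V E R \<Longrightarrow> x \<notin> V \<Longrightarrow> tri_sum s R x = 0"
  unfolding tri_sum_def by (intro sum.neutral) (auto dest: stacked_triangle_subset)

lemma tri_sum_cong: "(\<And>D. D \<in> R \<Longrightarrow> s D = s' D) \<Longrightarrow> tri_sum s R v = tri_sum s' R v"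
  unfolding tri_sum_def by (intro sum.cong) auto

text \<open>Each triangle meets the class exactly once. The total is therefore the same for all
  three colours, an invariant that detects equal colours.\<close>

lemma sum_tri_sum_colour_class:
  assumes st: "stacked c V E R" and k: "k < 3"
  shows "(\<Sum>v\<in>{v \<in> V. c v = k}. tri_sum s R v) = (\<Sum>D\<in>R. s D)"
proof -
  have "(\<Sum>v\<in>{v \<in> V. c v = k}. tri_sum s R v) =
      (\<Sum>D\<in>R. s D * (\<Sum>v\<in>{v \<in> V. c v = k}. of_bool (v \<in> D)))"
    unfolding tri_sum_def by (subst sum.swap) (simp only: sum_distrib_left)
  also have "\<dots> = (\<Sum>D\<in>R. s D)"
  proof (rule sum.cong)
    fix D assume D: "D \<in> R"
    obtain w where w: "\<And>v. v \<in> D \<and> c v = k \<longleftrightarrow> v = w"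
      using stacked_rainbow[OF st D k] by blast
    have wV: "w \<in> {v \<in> V. c v = k}"
      using w[of w] stacked_triangle_subset[OF st D] by auto
    have "(\<Sum>v\<in>{v \<in> V. c v = k}. of_bool (v \<in> D) :: int) =
        (\<Sum>v\<in>{v \<in> V. c v = k}. if v = w then 1 else 0)"
      by (rule sum.cong) (use w in auto)
    also have "\<dots> = 1" using wV stacked_finite[OF st] by (simp add: sum.delta)
    finally show "s D * (\<Sum>v\<in>{v \<in> V. c v = k}. of_bool (v \<in> D)) = s D" by simp
  qed simp
  finally show ?thesis .
qed

text \<open>If the colours differed, the classes of \<open>u\<close> and \<open>w\<close> would have
  totals \<kappa> and -\<kappa>. These agree modulo 3 only if \<kappa> vanishes.\<close>

lemma same_colour_of_tri_sum:
  assumes st: "stacked c V E R" and uw: "u \<in> V" "w \<in> V" and \<kappa>: "\<not> [\<kappa> = 0] (mod 3)"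
    and eq: "\<And>v. v \<in> V \<Longrightarrow>
      [tri_sum s R v = \<kappa> * (of_bool (v = u) - of_bool (v = w))] (mod 3)"
  shows "c u = c w"
proof (rule ccontr)
  assume ne: "c u \<noteq> c w"
  have fin: "finite V" using stacked_finite[OF st] by simp
  have cls: "[(\<Sum>D\<in>R. s D) = \<kappa> * (of_bool (c u = k) - of_bool (c w = k))] (mod 3)" if "k < 3" for k
  proof -
    have "[(\<Sum>v\<in>{v \<in> V. c v = k}. tri_sum s R v) =
        (\<Sum>v\<in>{v \<in> V. c v = k}. \<kappa> * (of_bool (v = u) - of_bool (v = w)))] (mod 3)"
      by (rule cong_sum) (use eq in auto)
    moreover have "(\<Sum>v\<in>{v \<in> V. c v = k}. \<kappa> * (of_bool (v = u) - of_bool (v = w))) =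
        \<kappa> * (of_bool (c u = k) - of_bool (c w = k))"
      using uw fin by (simp add: sum_distrib_left[symmetric] sum_subtractf of_bool_def sum.delta)
    ultimately show ?thesis using sum_tri_sum_colour_class[OF st that] by simp
  qed
  have "[\<kappa> = (\<Sum>D\<in>R. s D)] (mod 3)" "[- \<kappa> = (\<Sum>D\<in>R. s D)] (mod 3)"
    using cls[of "c u"] cls[of "c w"] ne uw stacked_colour[OF st] by (auto intro: cong_sym)
  then have "[\<kappa> = - \<kappa>] (mod 3)" using cong_sym cong_trans by blast
  then show False using \<kappa> by (simp add: cong_iff_dvd_diff) presburger
qed

text \<open>The last vertex lies in the last triangle only, so the value there is the coefficient of
  that triangle; peeling it off leaves the smaller graph.\<close>

lemma tri_sum_independent:
  "stacked c V E R \<Longrightarrow> (\<And>v. v \<in> V \<Longrightarrow> [tri_sum d R v = 0] (mod 3)) \<Longrightarrow> D \<in> R \<Longrightarrow> [d D = 0] (mod 3)"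
proof (induction rule: stacked.induct)
  case (triangle V E R e x a b)
  define T where "T = {x, t e, h e}"
  have "T \<notin> R" "finite R"
    using stacked_triangle_subset[OF triangle.hyps(1)] triangle.hyps(3)
      stacked_finite[OF triangle.hyps(1)] by (auto simp: T_def)
  then have ins: "tri_sum d (insert T R) v = d T * of_bool (v \<in> T) + tri_sum d R v" for v
    by (rule tri_sum_insert[rotated])
  have dT: "[d T = 0] (mod 3)"
    using triangle.prems(1)[of x] tri_sum_outside[OF triangle.hyps(1,3)] ins[of x]
    by (simp add: T_def)
  have "[tri_sum d R v = 0] (mod 3)" if "v \<in> V" for v
  proof -
    have "[d T * of_bool (v \<in> T) + tri_sum d R v = 0] (mod 3)"
      using triangle.prems(1)[of v] that ins[of v] by (simp add: T_def)
    then show ?thesis using dT by (cases "v \<in> T") (auto simp: cong_0_iff dvd_add_right_iff)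
  qed
  then have "[d D = 0] (mod 3)" if "D \<in> R" using triangle.IH that by simp
  moreover have "D = T \<or> D \<in> R" using triangle.prems(2) by (simp add: T_def)
  ultimately show ?case using dT by (elim disjE) simp_all
qed simp

section \<open>Links: differences of two equally coloured vertices as combinations of
  triangles\<close>

text \<open>The sign conditions at \<open>u\<close> and \<open>w\<close> keep the coefficients in \<open>{-1, 0, 1}\<close> when a triangle
  is exchanged in the induction below.\<close>

definition links :: "'v set set \<Rightarrow> ('v set \<Rightarrow> int) \<Rightarrow> 'v \<Rightarrow> 'v \<Rightarrow> bool" where
  "links R L u w \<longleftrightarrow> (\<forall>D. L D \<in> {-1, 0, 1}) \<and>
    (\<forall>D\<in>R. u \<in> D \<longrightarrow> L D \<ge> 0) \<and> (\<forall>D\<in>R. w \<in> D \<longrightarrow> L D \<le> 0) \<and>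
    (\<forall>v. tri_sum L R v = of_bool (v = u) - of_bool (v = w))"

lemma links_sym: "links R L u w \<Longrightarrow> links R (\<lambda>D. - L D) w u"
  unfolding links_def by (auto simp: tri_sum_def sum_negf)

text \<open>The essential case starts at the last vertex \<open>x\<close>. If \<open>p\<close> is
  the apex across the edge \<open>e\<close>, then \<open>x\<close> and \<open>p\<close> have the
  same colour and the new triangle minus the one at \<open>p\<close> represents their difference;
  this is added to a link from \<open>p\<close> to \<open>w\<close>.\<close>

lemma links_exists:
  "stacked c V E R \<Longrightarrow> u \<in> V \<Longrightarrow> w \<in> V \<Longrightarrow> c u = c w \<Longrightarrow> u \<noteq> w \<Longrightarrow> \<exists>L. links R L u w"
proof (induction arbitrary: u w rule: stacked.induct)
  case (edge a)
  then show ?case by auto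
next
  case (triangle V E R e x a b)
  note st = triangle.hyps(1) and ends = stacked_ends[OF triangle.hyps(1,2)]
  define T where "T = {x, t e, h e}"
  have TR: "T \<notin> R" and finR: "finite R"
    using stacked_triangle_subset[OF st] triangle.hyps(3)
      stacked_finite[OF st] by (auto simp: T_def)
  have new: "\<exists>L. links (insert T R) L x w" if w: "w \<in> V" "c x = c w" for w
  proof -
    have "w \<noteq> t e" "w \<noteq> h e" using w triangle.hyps(7,8) by auto
    then have "V \<noteq> {t e, h e}" using w by auto
    then obtain p where p: "p \<notin> {t e, h e}" "{p, t e, h e} \<in> R"
      using stacked_edge_apex[OF triangle.hyps(1,2)] by auto
    define T' where "T' = {p, t e, h e}"
    have T'R: "T' \<in> R" using p by (simp add: T'_def)
    have pV: "p \<in> V" using stacked_triangle_subset[OF st p(2)] by auto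
    obtain q where q: "\<And>v. v \<in> {p, t e, h e} \<and> c v = c p \<longleftrightarrow> v = q"
      using stacked_rainbow[OF st p(2) stacked_colour[OF st pV]] by blast
    have cp: "c p \<noteq> c (t e)" "c p \<noteq> c (h e)"
      using q[of p] q[of "t e"] q[of "h e"] p(1) by auto
    have "c p < 3" "c (t e) < 3" "c (h e) < 3" using stacked_colour[OF st] pV ends by auto
    then have cpx: "c p = c x" using cp ends triangle.hyps(6-8) by linarith
    \<comment> \<open>For \<open>p = w\<close> the zero combination replaces the link, which does
      not exist between a vertex and itself in the induction hypothesis.\<close>
    have "\<exists>L. links R L p w \<or> p = w \<and> L = (\<lambda>_. 0)"
      using triangle.IH[OF pV w(1)] cpx w(2) by (cases "p = w") auto
    then obtain L where L: "links R L p w \<or> p = w \<and> L = (\<lambda>_. 0)" by blast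
    have L1: "L D \<in> {-1, 0, 1}" for D using L by (auto simp: links_def)
    have L2: "D \<in> R \<Longrightarrow> p \<in> D \<Longrightarrow> L D \<ge> 0" for D using L by (auto simp: links_def)
    have L3: "D \<in> R \<Longrightarrow> w \<in> D \<Longrightarrow> L D \<le> 0" for D using L by (auto simp: links_def)
    have L4: "tri_sum L R v = of_bool (v = p) - of_bool (v = w)" for v
      using L by (auto simp: links_def tri_sum_def)
    \<comment> \<open>As \<open>p\<close> lies in \<open>T'\<close>, the sign condition gives
      \<open>L T'\<close> in \<open>{0, 1}\<close>; so subtracting 1 stays within the allowed
      range.\<close>
    define K where "K = (\<lambda>D. if D = T then 1 else if D = T' then L D - 1 else L D)"
    have LT': "L T' \<in> {0, 1}" using L1[of T'] L2[OF T'R] by (auto simp: T'_def)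
    have "tri_sum K R v = tri_sum L R v - of_bool (v \<in> T')" for v
    proof -
      have "tri_sum K R v = (\<Sum>D\<in>R. L D * of_bool (v \<in> D) - (if D = T' then of_bool (v \<in> T') else 0))"
        unfolding tri_sum_def by (rule sum.cong) (use TR in \<open>auto simp: K_def\<close>)
      then show ?thesis using T'R finR by (simp add: sum_subtractf tri_sum_def sum.delta)
    qed
    then have "tri_sum K (insert T R) v = of_bool (v = x) - of_bool (v = w)" for v
      using tri_sum_insert[OF finR TR, of K v] L4[of v] p(1) pV ends triangle.hyps(3)
      by (auto simp: K_def T_def T'_def of_bool_def)
    moreover have "w \<notin> T" using \<open>w \<noteq> t e\<close> \<open>w \<noteq> h e\<close> w triangle.hyps(3) by (auto simp: T_def)
    moreover have "x \<notin> D" if "D \<in> R" for D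
      using that stacked_triangle_subset[OF st] triangle.hyps(3) by auto
    ultimately have "links (insert T R) K x w"
      using L1 L3 LT' unfolding links_def by (auto simp: K_def)
    then show ?thesis by blast
  qed
  consider "u \<in> V" "w \<in> V" | "u = x" "w \<in> V" | "u \<in> V" "w = x"
    using triangle.prems by auto
  then have "\<exists>L. links (insert T R) L u w"
  proof cases
    case 1
    then obtain L where L: "links R L u w" using triangle.IH triangle.prems by blast
    have "tri_sum (L(T := 0)) R v = tri_sum L R v" for v
      by (rule tri_sum_cong) (use TR in auto)
    then have "links (insert T R) (L(T := 0)) u w"
      using L tri_sum_insert[OF finR TR, of "L(T := 0)"] unfolding links_def by auto
    then show ?thesis by blast
  next
    case 2
    then show ?thesis using new triangle.prems by simp
  next
    case 3
    then obtain L where "links (insert T R) L x u" using new[of u] triangle.prems by auto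
    then show ?thesis using 3 links_sym by blast
  qed
  then show ?case by (simp add: T_def)
qed

section \<open>Degrees in a triangle-tree\<close>

definition incidences :: "'e set \<Rightarrow> 'v \<Rightarrow> int" where
  "incidences E v = (\<Sum>e\<in>E. of_bool (v \<in> {t e, h e}))"

text \<open>The initial edge gives degree 1 and no triangle. Stacking adds one edge and one triangle
  at each old corner, while the new vertex gets two edges and one triangle.\<close>

lemma stacked_incidences:
  "stacked c V E R \<Longrightarrow> v \<in> V \<Longrightarrow> incidences E v = tri_sum (\<lambda>_. 1) R v + 1"
proof (induction rule: stacked.induct)
  case (edge a)
  then show ?case by (auto simp: incidences_def tri_sum_def)
next
  case (triangle V E R e x a b)
  note st = triangle.hyps(1) and ends = stacked_ends[OF triangle.hyps(1,2)]
  have teh: "t e \<noteq> h e" using ends by auto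
  note new = stacked_new[OF st triangle.hyps(3,4,5) teh]
  have fin: "finite E" "finite R" using stacked_finite[OF st] by auto
  have "incidences (insert a (insert b E)) v =
      of_bool (v \<in> {x, t e}) + of_bool (v \<in> {x, h e}) + incidences E v"
  proof -
    have "a \<notin> insert b E" using new by simp
    then show ?thesis using new(2) fin
      by (simp add: incidences_def triangle.hyps(4,5) del: insert_iff sum_of_bool_eq)
  qed
  moreover have "tri_sum (\<lambda>_. 1) (insert {x, t e, h e} R) v =
      of_bool (v \<in> {x, t e, h e}) + tri_sum (\<lambda>_. 1) R v"
    using tri_sum_insert[OF fin(2) new(4)] by simp
  moreover have "incidences E x = 0"
    unfolding incidences_def using stacked_ends[OF st] triangle.hyps(3)
    by (intro sum.neutral) auto
  ultimately show ?case
    using triangle.IH triangle.prems tri_sum_outside[OF st triangle.hyps(3)] teh ends triangle.hyps(3)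
    by (cases "v = x") (auto simp: of_bool_def)
qed

section \<open>The dichotomy between net outflows and triangle representations\<close>

text \<open>Signs suffice as values, because they represent all nonzero residues modulo 3.\<close>

definition feasible :: "'v set \<Rightarrow> 'e set \<Rightarrow> ('v \<Rightarrow> int) \<Rightarrow> bool" where
  "feasible V E \<beta> \<longleftrightarrow>
    (\<exists>f. (\<forall>e\<in>E. f e \<in> {1, -1}) \<and> (\<forall>v\<in>V. [net f E v = \<beta> v] (mod 3)))"

definition representable :: "'v set \<Rightarrow> 'v set set \<Rightarrow> ('v \<Rightarrow> int) \<Rightarrow> bool" where
  "representable V R \<beta> \<longleftrightarrow>
    (\<exists>s. (\<forall>D\<in>R. s D \<in> {1, -1}) \<and> (\<forall>v\<in>V. [tri_sum s R v = \<beta> v] (mod 3)))"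

lemma inc_sign:
  assumes "{t e, h e} = {p, q}"
  obtains \<epsilon> where "\<epsilon> \<in> {1, -1}" "\<And>v. inc e v = \<epsilon> * (of_bool (v = p) - of_bool (v = q))"
proof -
  from assms have "t e = p \<and> h e = q \<or> t e = q \<and> h e = p" by (simp add: doubleton_eq_iff)
  then show ?thesis
  proof
    assume "t e = p \<and> h e = q"
    then show ?thesis by (intro that[of 1]) (simp_all add: inc_def)
  next
    assume "t e = q \<and> h e = p"
    then show ?thesis by (intro that[of "-1"]) (simp_all add: inc_def)
  qed
qed

text \<open>Here \<open>p\<close> and \<open>q\<close> are the amounts sent from \<open>x\<close>
  along \<open>a\<close> and \<open>b\<close>. They arrive at \<open>y\<close> and \<open>z\<close>,
  where the old edges have to send out that much more.\<close>

lemma feasible_extend: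
  assumes st: "stacked c V E R" and x: "x \<notin> V" and yz: "y \<noteq> z"
    and a: "{t a, h a} = {x, y}" and b: "{t b, h b} = {x, z}"
    and ne: "x \<noteq> y" "x \<noteq> z"
    and pq: "p \<in> {1, -1}" "q \<in> {1, -1}" "[p + q = \<beta> x] (mod 3)"
    and feas: "feasible V E (\<lambda>v. \<beta> v + p * of_bool (v = y) + q * of_bool (v = z))"
  shows "feasible (insert x V) (insert a (insert b E)) \<beta>"
proof -
  obtain f where f: "\<And>e. e \<in> E \<Longrightarrow> f e \<in> {1, -1}"
    "\<And>v. v \<in> V \<Longrightarrow> [net f E v = \<beta> v + p * of_bool (v = y) + q * of_bool (v = z)] (mod 3)"
    using feas unfolding feasible_def by blast
  obtain \<epsilon> where \<epsilon>: "\<epsilon> \<in> {1, -1}" "\<And>v. inc a v = \<epsilon> * (of_bool (v = x) - of_bool (v = y))"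
    using inc_sign[OF a] by blast
  obtain \<delta> where \<delta>: "\<delta> \<in> {1, -1}" "\<And>v. inc b v = \<delta> * (of_bool (v = x) - of_bool (v = z))"
    using inc_sign[OF b] by blast
  note new = stacked_new[OF st x a b yz]
  \<comment> \<open>The signs \<epsilon> and \<delta> translate amounts leaving \<open>x\<close>
    into values for the fixed directions of \<open>a\<close> and \<open>b\<close>.\<close>
  define g where "g = f(a := p * \<epsilon>, b := q * \<delta>)"
  have fin: "finite E" using stacked_finite[OF st] by simp
  have "net g E v = net f E v" for v
    unfolding net_def by (rule sum.cong) (use new in \<open>auto simp: g_def\<close>)
  moreover have "net g (insert a (insert b E)) v = g a * inc a v + g b * inc b v + net g E v" for v
    using new fin by (simp add: net_def)
  moreover have "g a * \<epsilon> = p" "g b * \<delta> = q" using \<epsilon>(1) \<delta>(1) new(3) by (auto simp: g_def)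
  ultimately have net: "net g (insert a (insert b E)) v =
      p * (of_bool (v = x) - of_bool (v = y)) + q * (of_bool (v = x) - of_bool (v = z)) + net f E v" for v
    using \<epsilon>(2) \<delta>(2) by (simp add: mult.assoc[symmetric])
  have "[net g (insert a (insert b E)) v = \<beta> v] (mod 3)" if v: "v \<in> insert x V" for v
  proof (cases "v = x")
    case True
    have "net f E x = 0" using stacked_ends[OF st] x by (intro net_eq_0) auto
    then show ?thesis using net[of x] True pq(3) ne by simp
  next
    case False
    define X where "X = p * of_bool (v = y) + q * of_bool (v = z)"
    have "[net f E v = \<beta> v + X] (mod 3)"
      using f(2)[of v] v False by (simp add: X_def add.assoc)
    then have "[net f E v - X = \<beta> v + X - X] (mod 3)" by (intro cong_diff) auto
    moreover have "net g (insert a (insert b E)) v =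
        net f E v - X"
      using False net[of v] by (simp add: X_def)
    ultimately show ?thesis by simp
  qed
  moreover have "g e \<in> {1, -1}" if "e \<in> insert a (insert b E)" for e
    using that f(1)[of e] pq(1,2) \<epsilon>(1) \<delta>(1) by (auto simp: g_def)
  ultimately show ?thesis unfolding feasible_def by blast
qed

text \<open>The residue of \<beta> at the last vertex \<open>x\<close> decides: 0 leaves two choices
  of signs on the new edges and always ends in feasibility, while a nonzero residue leaves a single
  choice.\<close>

lemma feasible_or_representable:
  "stacked c V E R \<Longrightarrow> [(\<Sum>v\<in>V. \<beta> v) = 0] (mod 3) \<Longrightarrow> feasible V E \<beta> \<or> representable V R \<beta>"
proof (induction arbitrary: \<beta> rule: stacked.induct)
  case (edge a)
  have ne: "t a \<noteq> h a" using edge.hyps by auto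
  then have sum: "[\<beta> (t a) + \<beta> (h a) = 0] (mod 3)" using edge.prems by simp
  consider "[\<beta> (t a) = 0] (mod 3)" | "[\<beta> (t a) = 1] (mod 3)" | "[\<beta> (t a) = -1] (mod 3)"
    using cong_3_cases by blast
  then show ?case
  proof cases
    case 1
    then have "[\<beta> (h a) = 0] (mod 3)"
      using sum by (simp add: cong_0_iff dvd_add_right_iff)
    then show ?thesis using 1 by (simp add: representable_def tri_sum_def cong_sym_eq)
  next
    case 2
    then have "[\<beta> (h a) = -1] (mod 3)"
      using sum by (simp add: cong_iff_dvd_diff) presburger
    then show ?thesis using 2 ne unfolding feasible_def
      by (intro disjI1 exI[of _ "\<lambda>_. 1"]) (auto simp: net_def inc_def intro: cong_sym)
  next
    case 3
    then have "[\<beta> (h a) = 1] (mod 3)"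
      using sum by (simp add: cong_iff_dvd_diff) presburger
    then show ?thesis using 3 ne unfolding feasible_def
      by (intro disjI1 exI[of _ "\<lambda>_. -1"]) (auto simp: net_def inc_def intro: cong_sym)
  qed
next
  case (triangle V E R e x a b)
  note st = triangle.hyps(1) and x = triangle.hyps(3)
  note ends = stacked_ends[OF triangle.hyps(1,2)]
  define y z where "y = t e" and "z = h e"
  have yz: "y \<in> V" "z \<in> V" "y \<noteq> z" "c y \<noteq> c z" using ends by (auto simp: y_def z_def)
  have a: "{t a, h a} = {x, y}" and b: "{t b, h b} = {x, z}"
    using triangle.hyps(4,5) by (simp_all add: y_def z_def)
  have xyz: "x \<noteq> y" "x \<noteq> z" using yz x by auto
  define T where "T = {x, y, z}"
  note new = stacked_new[OF st x a b yz(3)]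
  have TR: "T \<notin> R" using new(4) by (simp add: T_def)
  have fin: "finite V" "finite R" using stacked_finite[OF st] by auto
  have sum: "[\<beta> x + (\<Sum>v\<in>V. \<beta> v) = 0] (mod 3)" using triangle.prems fin x by simp
  define \<gamma> where "\<gamma> p q v = \<beta> v + p * of_bool (v = y) + q * of_bool (v = z)" for p q v
  have step: "feasible (insert x V) (insert a (insert b E)) \<beta> \<or> representable V R (\<gamma> p q)"
    if pq: "p \<in> {1, -1}" "q \<in> {1, -1}" "[p + q = \<beta> x] (mod 3)" for p q
  proof -
    have "(\<Sum>v\<in>V. \<gamma> p q v) = (\<Sum>v\<in>V. \<beta> v) + (p + q)"
      using yz fin by (simp add: \<gamma>_def sum.distrib sum_distrib_left[symmetric] of_bool_def sum.delta)
    moreover have "[(\<Sum>v\<in>V. \<beta> v) + (p + q) = (\<Sum>v\<in>V. \<beta> v) + \<beta> x] (mod 3)"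
      using pq(3) by (intro cong_add) auto
    ultimately have "[(\<Sum>v\<in>V. \<gamma> p q v) = 0] (mod 3)"
      using sum cong_trans by (metis add.commute)
    then show ?thesis
      using triangle.IH[of "\<gamma> p q"] feasible_extend[where \<beta> = \<beta>, OF st x yz(3) a b xyz pq]
      unfolding \<gamma>_def by blast
  qed
  consider "[\<beta> x = 0] (mod 3)" | d where "d \<in> {1, -1}" "[\<beta> x = d] (mod 3)"
    using cong_3_cases[of "\<beta> x"] by blast
  then show ?case
  proof cases
    case 1
    \<comment> \<open>The two remaining demands differ by 2 at \<open>y\<close> and by -2 at
      \<open>z\<close>, and these vertices have different colours.\<close>
    have "\<not> (representable V R (\<gamma> 1 (-1)) \<and> representable V R (\<gamma> (-1) 1))"
    proof
      assume "representable V R (\<gamma> 1 (-1)) \<and> representable V R (\<gamma> (-1) 1)"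
      then obtain s s' where s: "\<And>v. v \<in> V \<Longrightarrow> [tri_sum s R v = \<gamma> 1 (-1) v] (mod 3)"
        "\<And>v. v \<in> V \<Longrightarrow> [tri_sum s' R v = \<gamma> (-1) 1 v] (mod 3)"
        unfolding representable_def by blast
      have "c y = c z"
      proof (rule same_colour_of_tri_sum[OF st yz(1,2)])
        show "\<not> [2 = 0::int] (mod 3)" by (simp add: cong_def)
        fix v assume "v \<in> V"
        then have "[tri_sum s R v - tri_sum s' R v = \<gamma> 1 (-1) v - \<gamma> (-1) 1 v] (mod 3)"
          using s by (intro cong_diff)
        moreover have "tri_sum s R v - tri_sum s' R v = tri_sum (\<lambda>D. s D - s' D) R v"
          by (simp add: tri_sum_def left_diff_distrib sum_subtractf)
        moreover have "\<gamma> 1 (-1) v - \<gamma> (-1) 1 v = 2 * (of_bool (v = y) - of_bool (v = z))"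
          by (simp add: \<gamma>_def)
        ultimately show "[tri_sum (\<lambda>D. s D - s' D) R v =
            2 * (of_bool (v = y) - of_bool (v = z))] (mod 3)" by simp
      qed
      then show False using yz(4) by simp
    qed
    moreover have "[1 + -1 = \<beta> x] (mod 3)" "[-1 + 1 = \<beta> x] (mod 3)"
      using cong_sym[OF 1] by simp_all
    ultimately show ?thesis using step[of 1 "-1"] step[of "-1" 1] by auto
  next
    case (2 d)
    \<comment> \<open>Both new edges must carry \<open>- d\<close>, since -2 is congruent to
      1.\<close>
    have "[- d + - d = \<beta> x] (mod 3)"
      using 2 by (auto simp: cong_iff_dvd_diff) presburger+
    moreover have "- d \<in> {1, -1}" using 2 by auto
    ultimately consider "feasible (insert x V) (insert a (insert b E)) \<beta>" | "representable V R (\<gamma> (- d) (- d))"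
      using step by blast
    then show ?thesis
    proof cases
      case 2
      then obtain s where s: "\<And>D. D \<in> R \<Longrightarrow> s D \<in> {1, -1}"
        "\<And>v. v \<in> V \<Longrightarrow> [tri_sum s R v = \<gamma> (- d) (- d) v] (mod 3)"
        unfolding representable_def by blast
      \<comment> \<open>Giving the new triangle the coefficient \<open>d\<close> produces the right
        value at \<open>x\<close> and cancels the shift by \<open>- d\<close> at both
        \<open>y\<close> and \<open>z\<close>.\<close>
      have "tri_sum (s(T := d)) R v = tri_sum s R v" for v
        by (rule tri_sum_cong) (use TR in auto)
      then have ins: "tri_sum (s(T := d)) (insert T R) v = d * of_bool (v \<in> T) + tri_sum s R v" for v
        using tri_sum_insert[OF fin(2) TR, of "s(T := d)"] by simp
      have "[tri_sum (s(T := d)) (insert T R) v = \<beta> v] (mod 3)" if v: "v \<in> insert x V" for v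
      proof (cases "v = x")
        case True
        then show ?thesis
          using ins[of x] tri_sum_outside[OF st x] \<open>[\<beta> x = d] (mod 3)\<close>
          by (simp add: T_def cong_sym_eq)
      next
        case False
        have "[d * of_bool (v \<in> T) + tri_sum s R v = d * of_bool (v \<in> T) + \<gamma> (- d) (- d) v] (mod 3)"
          using s(2) v False by (intro cong_add) auto
        moreover have "d * of_bool (v \<in> T) + \<gamma> (- d) (- d) v = \<beta> v"
          using False yz(3) by (auto simp: \<gamma>_def T_def)
        ultimately show ?thesis using ins by simp
      qed
      moreover have "\<forall>D\<in>insert T R. (s(T := d)) D \<in> {1, -1}"
        using s(1) \<open>d \<in> {1, -1}\<close> by auto
      ultimately have "representable (insert x V) (insert T R) \<beta>"
        unfolding representable_def by blast
      then show ?thesis by (simp add: T_def y_def z_def)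
    qed simp
  qed
qed

section \<open>The structure forced by the absence of a flow\<close>

text \<open>Every choice of signs on \<open>M\<close> leaves a demand that the tree cannot meet, so
  the dichotomy makes it representable. Comparing two choices that differ at one edge gives equal
  colours, hence links; independence of the triangles then governs their coefficients.\<close>

lemma links_of_no_mod_3_flow:
  assumes st: "stacked c V E R" and M: "finite M" "M \<inter> E = {}"
    and ends: "\<And>m. m \<in> M \<Longrightarrow> t m \<in> V \<and> h m \<in> V \<and> t m \<noteq> h m"
    and no_flow: "\<nexists>f. (\<forall>e\<in>E \<union> M. f e \<in> {1, -1}) \<and>
      (\<forall>v\<in>V. [net f (E \<union> M) v = 0] (mod 3))"
  shows "\<exists>L. (\<forall>m\<in>M. links R (L m) (t m) (h m)) \<and> (\<forall>D\<in>R. (\<Sum>m\<in>M. \<bar>L m D\<bar>) = 1)"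
proof -
  have fin: "finite V" "finite E" "finite R" using stacked_finite[OF st] by auto
  have rep: "representable V R (\<lambda>v. - net b M v)" if b: "\<And>m. b m \<in> {1, -1}" for b
  proof -
    have "(\<Sum>v\<in>V. - net b M v) = 0"
      using sum_net[of V M b] fin(1) ends by (simp add: sum_negf)
    moreover have "\<not> feasible V E (\<lambda>v. - net b M v)"
    proof
      assume "feasible V E (\<lambda>v. - net b M v)"
      then obtain f where f: "\<And>e. e \<in> E \<Longrightarrow> f e \<in> {1, -1}"
        "\<And>v. v \<in> V \<Longrightarrow> [net f E v = - net b M v] (mod 3)"
        unfolding feasible_def by blast
      define g where "g = (\<lambda>e. if e \<in> E then f e else b e)"
      have "[net g (E \<union> M) v = 0] (mod 3)" if "v \<in> V" for v
      proof -
        have "net g E v = net f E v" unfolding net_def by (rule sum.cong) (auto simp: g_def)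
        moreover have "net g M v = net b M v"
          unfolding net_def by (rule sum.cong) (use M(2) in \<open>auto simp: g_def\<close>)
        moreover have "net g (E \<union> M) v = net g E v + net g M v"
          unfolding net_def using fin(2) M by (intro sum.union_disjoint) auto
        ultimately show ?thesis using f(2)[OF that] by (simp add: cong_iff_dvd_diff)
      qed
      moreover have "g e \<in> {1, -1}" for e using f(1)[of e] b[of e] by (auto simp: g_def)
      ultimately show False using no_flow by blast
    qed
    ultimately show ?thesis using feasible_or_representable[OF st, of "\<lambda>v. - net b M v"] by auto
  qed
  have "\<exists>L. links R L (t m) (h m)" if m: "m \<in> M" for m
  proof -
    define b :: "'e \<Rightarrow> int" where "b = (\<lambda>_. 1)"
    define b' where "b' = b(m := -1)"
    have "representable V R (\<lambda>v. - net b M v)" "representable V R (\<lambda>v. - net b' M v)"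
      by (rule rep; simp add: b_def b'_def)+
    then obtain s s' where s: "\<And>v. v \<in> V \<Longrightarrow> [tri_sum s R v = - net b M v] (mod 3)"
      "\<And>v. v \<in> V \<Longrightarrow> [tri_sum s' R v = - net b' M v] (mod 3)"
      unfolding representable_def by blast
    have "c (t m) = c (h m)"
    proof (rule same_colour_of_tri_sum[OF st])
      show "t m \<in> V" "h m \<in> V" using ends[OF m] by auto
      show "\<not> [-2 = 0::int] (mod 3)" by (simp add: cong_def)
      fix v assume "v \<in> V"
      then have "[tri_sum s R v - tri_sum s' R v = - net b M v - - net b' M v] (mod 3)"
        using s by (intro cong_diff)
      moreover have "tri_sum s R v - tri_sum s' R v = tri_sum (\<lambda>D. s D - s' D) R v"
        by (simp add: tri_sum_def left_diff_distrib sum_subtractf)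
      moreover have "- net b M v - - net b' M v = -2 * (of_bool (v = t m) - of_bool (v = h m))"
      proof -
        have "net b' (M - {m}) v = net b (M - {m}) v"
          unfolding net_def by (rule sum.cong) (auto simp: b'_def)
        moreover have "net k M v = k m * inc m v + net k (M - {m}) v" for k
          unfolding net_def using M(1) m by (rule sum.remove)
        ultimately show ?thesis by (simp add: b_def b'_def inc_def)
      qed
      ultimately show "[tri_sum (\<lambda>D. s D - s' D) R v =
          -2 * (of_bool (v = t m) - of_bool (v = h m))] (mod 3)" by (simp only:)
    qed
    then show ?thesis using links_exists[OF st] ends[OF m] by blast
  qed
  then have "\<forall>m\<in>M. \<exists>L. links R L (t m) (h m)" by blast
  then obtain L where "\<forall>m\<in>M. links R (L m) (t m) (h m)" by (rule bchoice[THEN exE])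
  then have L: "\<And>m. m \<in> M \<Longrightarrow> links R (L m) (t m) (h m)" by blast
  have "(\<Sum>m\<in>M. \<bar>L m D\<bar>) = 1" if D: "D \<in> R" for D
  proof (rule unique_nonzero_coefficient[OF M(1)])
    show "L m D \<in> {-1, 0, 1}" if "m \<in> M" for m using L[OF that] by (simp add: links_def)
    fix b :: "'e \<Rightarrow> int" assume b: "\<And>m. b m \<in> {1, -1}"
    obtain s where s: "\<And>D. D \<in> R \<Longrightarrow> s D \<in> {1, -1}"
      "\<And>v. v \<in> V \<Longrightarrow> [tri_sum s R v = - net b M v] (mod 3)"
      using rep[of b, OF b] unfolding representable_def by blast
    \<comment> \<open>The links represent \<open>net b M\<close> and \<open>s\<close> represents its
      negative, so \<open>d\<close> represents 0 and vanishes modulo 3. As \<open>s D\<close> is a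
      sign, the other summand cannot vanish.\<close>
    define d where "d D = s D + (\<Sum>m\<in>M. b m * L m D)" for D
    have "[tri_sum d R v = 0] (mod 3)" if "v \<in> V" for v
    proof -
      have "(\<Sum>D\<in>R. (\<Sum>m\<in>M. b m * L m D) * of_bool (v \<in> D)) =
          (\<Sum>D\<in>R. \<Sum>m\<in>M. b m * (L m D * of_bool (v \<in> D)))"
        by (simp only: sum_distrib_right mult.assoc)
      also have "\<dots> = (\<Sum>m\<in>M. b m * tri_sum (L m) R v)"
        unfolding tri_sum_def sum_distrib_left by (rule sum.swap)
      also have "\<dots> = net b M v"
        unfolding net_def by (rule sum.cong) (use L in \<open>auto simp: links_def inc_def\<close>)
      finally have "tri_sum d R v = tri_sum s R v + net b M v"
        unfolding tri_sum_def d_def by (simp only: distrib_right sum.distrib)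
      then show ?thesis using s(2)[OF that] by (simp add: cong_iff_dvd_diff)
    qed
    then have "[d D = 0] (mod 3)" using tri_sum_independent[OF st] D by blast
    then have "3 dvd s D + (\<Sum>m\<in>M. b m * L m D)" by (simp add: d_def cong_0_iff)
    moreover have "\<not> 3 dvd s D" using s(1)[OF D] by auto
    ultimately show "\<not> [(\<Sum>m\<in>M. b m * L m D) = 0] (mod 3)"
      using dvd_add_left_iff[of 3] unfolding cong_0_iff by blast
  qed
  then show ?thesis using L by blast
qed

section \<open>Counting degrees\<close>

lemma sum_incidences:
  assumes "finite V" and "\<And>e. e \<in> E \<Longrightarrow> t e \<in> V \<and> h e \<in> V \<and> t e \<noteq> h e"
  shows "(\<Sum>v\<in>V. incidences E v) = 2 * int (card E)"
proof -
  have "(\<Sum>v\<in>V. incidences E v) = (\<Sum>e\<in>E. \<Sum>v\<in>V. of_bool (v \<in> {t e, h e}))"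
    unfolding incidences_def by (rule sum.swap)
  also have "\<dots> = (\<Sum>e\<in>E. 2)"
  proof (rule sum.cong)
    fix e assume "e \<in> E"
    then have "V \<inter> {v. v \<in> {t e, h e}} = {t e, h e}" "card {t e, h e} = 2"
      using assms(2) by auto
    then show "(\<Sum>v\<in>V. of_bool (v \<in> {t e, h e}) :: int) = 2"
      using assms(1) by (simp del: insert_iff)
  qed simp
  finally show ?thesis by simp
qed

lemma incidences_Un:
  "finite E \<Longrightarrow> finite M \<Longrightarrow> M \<inter> E = {} \<Longrightarrow>
    incidences (E \<union> M) v = incidences E v + incidences M v"
  unfolding incidences_def by (intro sum.union_disjoint) auto

text \<open>Without a flow the supports of the links partition \<open>R\<close>. This bounds
  \<open>card M\<close> and fixes the parity of all degrees, and the degree sum then forces four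
  vertices of degree 3.\<close>

lemma mod_3_flow_exists:
  assumes st: "stacked c V E R" and R: "R \<noteq> {}" and M: "finite M" "M \<inter> E = {}"
    and ends: "\<And>m. m \<in> M \<Longrightarrow> t m \<in> V \<and> h m \<in> V \<and> t m \<noteq> h m"
    and three: "card {v \<in> V. incidences (E \<union> M) v = 3} \<le> 3"
  shows "\<exists>f. (\<forall>e\<in>E \<union> M. f e \<in> {1, -1}) \<and> (\<forall>v\<in>V. [net f (E \<union> M) v = 0] (mod 3))"
proof (rule ccontr)
  assume "\<not> ?thesis"
  from links_of_no_mod_3_flow[OF st M ends this]
  obtain L where L: "\<And>m. m \<in> M \<Longrightarrow> links R (L m) (t m) (h m)"
    "\<And>D. D \<in> R \<Longrightarrow> (\<Sum>m\<in>M. \<bar>L m D\<bar>) = 1" by blast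
  have fin: "finite V" "finite E" "finite R" using stacked_finite[OF st] by auto
  have "2 * int (card M) = (\<Sum>m\<in>M. 2)" by simp
  also have "\<dots> \<le> (\<Sum>m\<in>M. \<Sum>D\<in>R. \<bar>L m D\<bar>)"
  proof (rule sum_mono)
    fix m assume m: "m \<in> M"
    \<comment> \<open>The values 1 and -1 at the two ends differ by 2, and each triangle contributes
      at most the absolute value of its coefficient to this difference.\<close>
    have "(\<Sum>D\<in>R. L m D * of_bool (t m \<in> D) - L m D * of_bool (h m \<in> D)) =
        tri_sum (L m) R (t m) - tri_sum (L m) R (h m)"
      by (simp add: tri_sum_def sum_subtractf)
    also have "\<dots> = 2" using L(1)[OF m] ends[OF m] not_sym[of "t m" "h m"] by (simp add: links_def)
    finally have "2 = (\<Sum>D\<in>R. L m D * of_bool (t m \<in> D) - L m D * of_bool (h m \<in> D))" ..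
    also have "\<dots> \<le> (\<Sum>D\<in>R. \<bar>L m D\<bar>)" by (rule sum_mono) (simp add: of_bool_def abs_ge_self abs_ge_minus_self)
    finally show "2 \<le> (\<Sum>D\<in>R. \<bar>L m D\<bar>)" .
  qed
  also have "\<dots> = (\<Sum>D\<in>R. \<Sum>m\<in>M. \<bar>L m D\<bar>)" by (rule sum.swap)
  also have "\<dots> = int (card R)" using L(2) by simp
  finally have cardM: "2 * int (card M) \<le> int (card R)" .
  have odd_ge: "odd (incidences (E \<union> M) v) \<and> incidences (E \<union> M) v \<ge> 3" if v: "v \<in> V" for v
  proof -
    have "tri_sum (\<lambda>_. 1) R v = (\<Sum>D\<in>R. \<Sum>m\<in>M. \<bar>L m D\<bar> * of_bool (v \<in> D))"
      unfolding tri_sum_def by (rule sum.cong) (simp_all add: L(2) sum_distrib_right[symmetric])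
    also have "\<dots> = (\<Sum>m\<in>M. \<Sum>D\<in>R. \<bar>L m D\<bar> * of_bool (v \<in> D))" by (rule sum.swap)
    finally have tri: "tri_sum (\<lambda>_. 1) R v = (\<Sum>m\<in>M. \<Sum>D\<in>R. \<bar>L m D\<bar> * of_bool (v \<in> D))" .
    \<comment> \<open>An integer and its absolute value have the same parity, so the number of
      triangles at \<open>v\<close> has the parity of the number of ends of links there.\<close>
    have "even (tri_sum (\<lambda>_. 1) R v - incidences M v)"
      unfolding tri incidences_def sum_subtractf[symmetric]
    proof (rule dvd_sum)
      fix m assume m: "m \<in> M"
      have "even (\<Sum>D\<in>R. \<bar>L m D\<bar> * of_bool (v \<in> D) - L m D * of_bool (v \<in> D))"
        by (rule dvd_sum) (auto simp: of_bool_def)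
      then have "even ((\<Sum>D\<in>R. \<bar>L m D\<bar> * of_bool (v \<in> D)) - tri_sum (L m) R v)"
        by (simp only: sum_subtractf tri_sum_def)
      then show "even ((\<Sum>D\<in>R. \<bar>L m D\<bar> * of_bool (v \<in> D)) - of_bool (v \<in> {t m, h m}))"
        using L(1)[OF m] ends[OF m] by (auto simp: links_def of_bool_def split: if_splits)
    qed
    moreover have inc: "incidences (E \<union> M) v = tri_sum (\<lambda>_. 1) R v + 1 + incidences M v"
      using incidences_Un[OF fin(2) M] stacked_incidences[OF st v] by simp
    ultimately have odd: "odd (incidences (E \<union> M) v)" by simp
    obtain D where "D \<in> R" "v \<in> D" using stacked_covered[OF st R v] by blast
    then have "tri_sum (\<lambda>_. 1) R v > 0"
      unfolding tri_sum_def using fin(3) by (intro sum_pos2[where i = D]) auto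
    moreover have "incidences M v \<ge> 0" unfolding incidences_def by (rule sum_nonneg) simp
    ultimately have "incidences (E \<union> M) v \<ge> 2" using inc by linarith
    moreover have "incidences (E \<union> M) v \<noteq> 2" using odd by auto
    ultimately show ?thesis using odd by simp
  qed
  define K where "K = {v \<in> V. incidences (E \<union> M) v = 3}"
  \<comment> \<open>An odd degree of at least 3 that is not 3 is at least 5. With
    \<open>n = card V\<close> this yields \<open>5 * n - 2 * card K\<close> as a lower bound,
    against the upper bound \<open>5 * n - 8\<close>.\<close>
  have "(\<Sum>v\<in>V. 5 - 2 * of_bool (v \<in> K)) \<le> (\<Sum>v\<in>V. incidences (E \<union> M) v)"
  proof (rule sum_mono)
    fix v assume v: "v \<in> V"
    have "incidences (E \<union> M) v \<noteq> 4" using odd_ge[OF v] by auto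
    then have "incidences (E \<union> M) v = 3 \<or> incidences (E \<union> M) v \<ge> 5"
      using odd_ge[OF v] by linarith
    then show "5 - 2 * of_bool (v \<in> K) \<le> incidences (E \<union> M) v" using v by (auto simp: K_def)
  qed
  moreover have "(\<Sum>v\<in>V. 5 - 2 * of_bool (v \<in> K)) = 5 * int (card V) - 2 * int (card K)"
  proof -
    have "V \<inter> {v. v \<in> K} = K" by (auto simp: K_def)
    then show ?thesis using fin(1) by (simp add: sum_subtractf sum_distrib_left[symmetric])
  qed
  moreover have "(\<Sum>v\<in>V. incidences (E \<union> M) v) = 2 * int (card (E \<union> M))"
  proof (rule sum_incidences[OF fin(1)])
    show "t e \<in> V \<and> h e \<in> V \<and> t e \<noteq> h e" if "e \<in> E \<union> M" for e
      using that stacked_ends[OF st, of e] ends[of e] by auto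
  qed
  moreover have "card (E \<union> M) = card E + card M"
    using fin(2) M by (intro card_Un_disjoint) auto
  moreover have "card V = card R + 2" "card E = 2 * card R + 1" using stacked_card[OF st] by auto
  moreover have "card K \<le> 3" using three by (simp add: K_def)
  ultimately show False using cardM by simp
qed

section \<open>From triangle-trees to stacked triangles\<close>

text \<open>The new vertex receives the colour missing at the ends of \<open>e\<close>. Since
  \<open>y\<close> and \<open>z\<close> may match these ends in either order, \<open>a\<close> and
  \<open>b\<close> may have to be exchanged.\<close>

lemma stacked_extend:
  assumes st: "stacked c V E R" and e: "e \<in> E" "{t e, h e} = {y, z}" and x: "x \<notin> V"
    and a: "{t a, h a} = {x, y}" and b: "{t b, h b} = {x, z}"
  shows "\<exists>c' R'. stacked c' (insert x V) (insert a (insert b E)) R' \<and> R' \<noteq> {}"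
proof -
  have "\<exists>k<3. k \<noteq> i \<and> k \<noteq> j" for i j :: nat
    by presburger
  then obtain k where k: "k < 3" "k \<noteq> c (t e)" "k \<noteq> c (h e)" by blast
  have te: "t e \<noteq> x" "h e \<noteq> x" using stacked_ends[OF st e(1)] x by auto
  have st': "stacked (c(x := k)) V E R"
    by (rule stacked_cong[OF st]) (use x in auto)
  have "stacked (c(x := k)) (insert x V) (insert p (insert q E)) (insert {x, t e, h e} R)"
    if "{t p, h p} = {x, t e}" "{t q, h q} = {x, h e}" for p q
    by (rule stacked.triangle[OF st' e(1) x that]) (use k te in simp_all)
  note ext = this
  have "y = t e \<and> z = h e \<or> y = h e \<and> z = t e"
    using e(2) by (auto simp: doubleton_eq_iff)
  then show ?thesis
  proof
    assume "y = t e \<and> z = h e"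
    then show ?thesis using ext[of a b] a b by blast
  next
    assume "y = h e \<and> z = t e"
    then have "stacked (c(x := k)) (insert x V) (insert b (insert a E)) (insert {x, t e, h e} R)"
      using ext[of b a] a b by simp
    then show ?thesis unfolding insert_commute[of b a] by blast
  qed
qed

lemma stacked_of_triangle_tree:
  "triangle_tree_on \<eta> V E \<Longrightarrow> (\<And>e. e \<in> E \<Longrightarrow> \<eta> e = {t e, h e}) \<Longrightarrow>
    \<exists>c R. stacked c V E R \<and> R \<noteq> {}"
proof (induction rule: triangle_tree_on.induct)
  case (triangle x1 x2 x3 a b c)
  \<comment> \<open>Only the colours of \<open>x1\<close> and \<open>x2\<close> matter here;
    stacking \<open>x3\<close> on their edge assigns it a new colour.\<close>
  define k where "k = (\<lambda>v. if v = x1 then 0 else 1 :: nat)"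
  have a: "{t a, h a} = {x1, x2}" and b: "{t b, h b} = {x3, x1}" and c: "{t c, h c} = {x3, x2}"
    using triangle.prems[of a] triangle.prems[of b] triangle.prems[of c] triangle.hyps by auto
  have "t a = x1 \<and> h a = x2 \<or> t a = x2 \<and> h a = x1" using a by (simp add: doubleton_eq_iff)
  then have "stacked k {t a, h a} {a} {}"
    using triangle.hyps(1) by (intro stacked.edge) (auto simp: k_def)
  moreover have "x3 \<notin> {t a, h a}" using a triangle.hyps(1) by auto
  ultimately have "\<exists>c' R'. stacked c' (insert x3 {t a, h a}) (insert b (insert c {a})) R' \<and> R' \<noteq> {}"
    using stacked_extend[of k "{t a, h a}" "{a}" "{}" a x1 x2 x3 b c] a b c by simp
  moreover have "insert x3 {t a, h a} = {x1, x2, x3}" "insert b (insert c {a}) = {a, b, c}"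
    using a by auto
  ultimately show ?case by simp
next
  case (add_vertex V E e y z x a b)
  then obtain c R where "stacked c V E R" by auto
  moreover have "{t e, h e} = {y, z}" "{t a, h a} = {x, y}" "{t b, h b} = {x, z}"
    using add_vertex.prems[of e] add_vertex.prems[of a] add_vertex.prems[of b] add_vertex.hyps
    by simp_all
  ultimately show ?case using stacked_extend add_vertex.hyps(2,5) by blast
qed

end

section \<open>The result for graphs, by way of an arbitrary orientation\<close>

theorem corollary1p7:
  fixes G :: "('v, 'e) mgraph"
  assumes "multigraph G"
    and "\<exists>H. spanning_triangle_tree H G"
    and "card {v \<in> vertices G. degree G v = 3} \<le> 3"
  shows "\<exists>D f. nowhere_zero_3_flow G D f"
proof -
  interpret multigraph G by fact
  have "\<forall>e\<in>edges G. \<exists>pq. ends G e = {fst pq, snd pq} \<and> fst pq \<noteq> snd pq"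
    using card_ends by (force simp: card_2_iff)
  then obtain pq where pq: "\<forall>e\<in>edges G. ends G e = {fst (pq e), snd (pq e)} \<and> fst (pq e) \<noteq> snd (pq e)"
    by (meson bchoice)
  define t h where "t = fst \<circ> pq" and "h = snd \<circ> pq"
  have th: "ends G e = {t e, h e}" "t e \<noteq> h e" if "e \<in> edges G" for e
    using pq that by (auto simp: t_def h_def)
  have thV: "t e \<in> vertices G \<and> h e \<in> vertices G" if "e \<in> edges G" for e
    using ends_subset[OF that] th[OF that] by simp
  obtain H where H: "subgraph_of H G" "vertices H = vertices G" "triangle_tree H"
    using assms(2) by (auto simp: spanning_triangle_tree_def)
  have sub: "edges H \<subseteq> edges G" "\<And>e. e \<in> edges H \<Longrightarrow> ends H e = ends G e"
    using H(1) by (auto simp: subgraph_of_def)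
  have "\<exists>c R. stacked t h c (vertices G) (edges H) R \<and> R \<noteq> {}"
    using H(3) sub th(1) unfolding triangle_tree_def H(2)
    by (intro stacked_of_triangle_tree[of "ends H"]) auto
  then obtain c R where st: "stacked t h c (vertices G) (edges H) R" "R \<noteq> {}" by blast
  define M where "M = edges G - edges H"
  have M: "edges H \<union> M = edges G" "M \<inter> edges H = {}" "finite M"
    using sub(1) finite_edges by (auto simp: M_def)
  have "incidences t h (edges G) v = int (degree G v)" for v
  proof -
    have "incidences t h (edges G) v = (\<Sum>e\<in>edges G. of_bool (v \<in> ends G e))"
      unfolding incidences_def by (rule sum.cong) (simp_all add: th(1))
    then show ?thesis
      using finite_edges by (simp add: degree_def Int_def)
  qed
  then have "card {v \<in> vertices G. incidences t h (edges H \<union> M) v = 3} \<le> 3"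
    using assms(3) unfolding M(1) by simp
  then have "\<exists>f. (\<forall>e\<in>edges H \<union> M. f e \<in> {1, -1}) \<and>
      (\<forall>v\<in>vertices G. [net t h f (edges H \<union> M) v = 0] (mod 3))"
    using th(2) thV M by (intro mod_3_flow_exists[OF st]) auto
  then obtain f where f: "\<And>e. e \<in> edges G \<Longrightarrow> f e \<in> {1, -1}"
    "\<And>v. v \<in> vertices G \<Longrightarrow> [net t h f (edges G) v = 0] (mod 3)"
    unfolding M(1) by blast
  have "\<exists>g. (\<forall>e\<in>edges G. g e \<in> {1, -1, 2, -2}) \<and> (\<forall>v\<in>vertices G. net t h g (edges G) v = 0)"
  proof (rule integer_flow_of_mod_3_flow[OF finite_vertices finite_edges thV])
    show "f e \<in> {1, -1, 2, -2}" if "e \<in> edges G" for e using f(1)[OF that] by auto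
    show "3 dvd net t h f (edges G) v" if "v \<in> vertices G" for v
      using f(2)[OF that] by (simp add: cong_0_iff)
  qed
  then obtain g where g: "\<And>e. e \<in> edges G \<Longrightarrow> g e \<in> {1, -1, 2, -2}"
    "\<And>v. v \<in> vertices G \<Longrightarrow> net t h g (edges G) v = 0" by blast
  \<comment> \<open>The arbitrary orientation chosen at the start serves as the final one, because
    the flow values may be negative.\<close>
  define D where "D = \<lparr>verts = vertices G, arcs = edges G, tail = t, head = h\<rparr>"
  have "(\<Sum>e\<in>out_arcs D v. g e) - (\<Sum>e\<in>in_arcs D v. g e) = net t h g (edges G) v" for v
  proof -
    have "(\<Sum>e\<in>out_arcs D v. g e) = (\<Sum>e\<in>edges G. if v = t e then g e else 0)"
      unfolding out_arcs_def D_def using finite_edges by (simp add: sum.inter_filter eq_commute)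
    moreover have "(\<Sum>e\<in>in_arcs D v. g e) = (\<Sum>e\<in>edges G. if v = h e then g e else 0)"
      unfolding in_arcs_def D_def using finite_edges by (simp add: sum.inter_filter eq_commute)
    moreover have "net t h g (edges G) v =
        (\<Sum>e\<in>edges G. (if v = t e then g e else 0) - (if v = h e then g e else 0))"
      unfolding net_def inc_def by (rule sum.cong) auto
    ultimately show ?thesis by (simp add: sum_subtractf)
  qed
  moreover have "orientation_of D G"
    using th(1) by (simp add: orientation_of_def D_def)
  ultimately have "nowhere_zero_3_flow G D g"
    using g unfolding nowhere_zero_3_flow_def by (metis eq_iff_diff_eq_0)
  then show ?thesis by blast
qed

end
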